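(* Let $a, b, c, d$ be rational numbers with $b > 0$ and $d > 0$, and let $m$ and $n$ be natural numbers greater than $1$ such that both $\sqrt[m]{b}$ and $\sqrt[n]{d}$ are irrational. If $a + \sqrt[m]{b} = c + \sqrt[n]{d}$, then $a = c$ and $\sqrt[m]{b} = \sqrt[n]{d}$.
   Context: Natural numbers are the positive integers, and $\sqrt[n]{A}$ denotes the positive real $n$-th root of a positive rational number $A$. *)

theory Defs
  imports Complex_Main
begin

end

theory Submission
  imports Defs "HOL-Computational_Algebra.Computational_Algebra"
    "HOL-Computational_Algebra.Field_as_Ring"
begin

text \<open>
  If \<open>\<delta> > 0\<close> and \<open>r > 0\<close> with \<open>r\<close>, \<open>\<delta> ^ n\<close>, \<open>(\<delta> + r) ^ m\<close> rational, consider the greatest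
  common divisor over the rationals of \<open>X ^ n - \<delta> ^ n\<close> and \<open>(X + r) ^ m - (\<delta> + r) ^ m\<close>. Its complex
  roots \<open>z\<close> satisfy \<open>\<bar>z\<bar> = \<delta>\<close> and \<open>\<bar>z + r\<bar> = \<delta> + r = \<bar>z\<bar> + r\<close>, which forces \<open>z = \<delta>\<close>. The root is
  simple, so the gcd is linear and \<open>\<delta>\<close> is rational.
\<close>

lemma map_poly_of_rat_add:
  "map_poly of_rat (p + q) = (map_poly of_rat p + map_poly of_rat q :: 'a::field_char_0 poly)"
  by (rule poly_eqI) (simp add: coeff_map_poly of_rat_add)

lemma map_poly_of_rat_diff:
  "map_poly of_rat (p - q) = (map_poly of_rat p - map_poly of_rat q :: 'a::field_char_0 poly)"
  by (rule poly_eqI) (simp add: coeff_map_poly of_rat_diff)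

lemma map_poly_of_rat_mult:
  "map_poly of_rat (p * q) = (map_poly of_rat p * map_poly of_rat q :: 'a::field_char_0 poly)"
  by (rule poly_eqI) (simp add: coeff_map_poly coeff_mult of_rat_sum of_rat_mult)

lemma map_poly_of_rat_power:
  "map_poly of_rat (p ^ n) = (map_poly of_rat p ^ n :: 'a::field_char_0 poly)"
  by (induction n) (simp_all add: map_poly_of_rat_mult)

lemma map_poly_of_rat_dvd:
  "p dvd q \<Longrightarrow> map_poly of_rat p dvd (map_poly of_rat q :: 'a::field_char_0 poly)"
  by (auto simp: dvd_def map_poly_of_rat_mult)

text \<open>The gcd is the same over the rationals and over the complex numbers, so it can be pinned
  down by its complex roots: \<open>x\<close> is the only one and has multiplicity one. A linear
  rational polynomial has a rational root.\<close>

lemma unique_simple_common_root_in_Rats: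
  fixes p q :: "rat poly" and x :: complex
  assumes p: "poly (map_poly of_rat p) x = 0" and q: "poly (map_poly of_rat q) x = 0"
    and simple_root: "poly (pderiv (map_poly of_rat p)) x \<noteq> 0"
    and unique: "\<And>z. poly (map_poly of_rat p) z = 0 \<Longrightarrow> poly (map_poly of_rat q) z = 0 \<Longrightarrow> z = x"
  shows "x \<in> \<rat>"
proof -
  define g where "g = gcd p q"
  define G :: "complex poly" where "G = map_poly of_rat g"
  have "p \<noteq> 0" using simple_root by auto
  hence "g \<noteq> 0" by (simp add: g_def)
  hence "G \<noteq> 0" by (simp add: G_def map_poly_eq_0_iff)
  have deg: "degree G = degree g" by (simp add: G_def degree_map_poly)
  have dvd: "G dvd map_poly of_rat p" "G dvd map_poly of_rat q"
    unfolding G_def g_def by (intro map_poly_of_rat_dvd gcd_dvd1 gcd_dvd2)+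
  \<comment> \<open>The Bezout identity survives the embedding into \<open>complex poly\<close>, so
    \<open>G\<close> vanishes wherever both polynomials do.\<close>
  obtain u v where uv: "u * p + v * q = g"
    using bezout_coefficients_fst_snd g_def by blast
  have "G = map_poly of_rat u * map_poly of_rat p + map_poly of_rat v * map_poly of_rat q"
    by (simp add: G_def uv[symmetric] map_poly_of_rat_add map_poly_of_rat_mult)
  hence "poly G x = 0" using p q by simp
  then obtain H where H: "G = [:-x, 1:] * H" by (auto simp: poly_eq_0_iff_dvd)
  have "H \<noteq> 0" using H \<open>G \<noteq> 0\<close> by auto
  \<comment> \<open>A root of a nonconstant \<open>H\<close> would be a common root, hence
    \<open>x\<close> again, and \<open>x\<close> would be at least a double root of
    \<open>p\<close>.\<close>
  have "degree H = 0"
  proof (rule ccontr)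
    assume "degree H \<noteq> 0"
    then obtain z where z: "poly H z = 0"
      using fundamental_theorem_of_algebra_alt[of H] by (metis degree_pCons_0)
    hence "poly G z = 0" by (simp add: H)
    hence "z = x" using unique dvd by (auto simp: poly_eq_0_iff_dvd intro: dvd_trans)
    with z obtain K where "H = [:-x, 1:] * K" by (auto simp: poly_eq_0_iff_dvd)
    moreover obtain L where "map_poly of_rat p = G * L" using dvd by (auto simp: dvd_def)
    ultimately have "map_poly of_rat p = [:-x, 1:] * ([:-x, 1:] * (K * L))"
      by (simp only: H mult.assoc)
    hence "poly (pderiv (map_poly of_rat p)) x = 0"
      by (simp only: pderiv_mult) simp
    with simple_root show False by simp
  qed
  then obtain h where "H = [:h:]" by (rule degree_eq_zeroE)
  hence "degree g = 1"
    using \<open>H \<noteq> 0\<close> by (simp add: deg[symmetric] H)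
  then obtain t s where st: "g = [:s, t:]" "t \<noteq> 0"
    by (rule degree1_coeffs)
  have "of_rat s + x * of_rat t = 0"
    using \<open>poly G x = 0\<close> st by (simp add: G_def map_poly_pCons)
  hence "x = of_rat (- s / t)"
    using \<open>t \<noteq> 0\<close> by (simp add: of_rat_divide of_rat_minus field_simps eq_neg_iff_add_eq_0)
  thus ?thesis by simp
qed

text \<open>The circles of radius \<open>s\<close> about 0 and of radius \<open>s + r\<close> about
  \<open>-r\<close> are internally tangent, and they touch only at \<open>s\<close>.\<close>

lemma complex_eq_of_norm_add_real:
  fixes z :: complex and r s :: real
  assumes "norm z = s" and "norm (z + of_real r) = s + r" and "r > 0"
  shows "z = of_real s"
proof -
  have 1: "(Re z)\<^sup>2 + (Im z)\<^sup>2 = s\<^sup>2" using assms(1) by (simp add: cmod_power2 flip: assms(1))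
  have "(Re z + r)\<^sup>2 + (Im z)\<^sup>2 = (s + r)\<^sup>2"
    using cmod_power2[of "z + of_real r"] assms(2) by simp
  with 1 have "2 * Re z * r = 2 * s * r" unfolding power2_sum by linarith
  hence "Re z = s" using \<open>r > 0\<close> by simp
  with 1 show ?thesis by (simp add: complex_eq_iff)
qed

lemma Rats_of_power_and_shifted_power:
  fixes x :: real and r b d :: rat
  assumes "x > 0" "r > 0" "m > 0" "n > 0"
    and x: "x ^ n = of_rat d" and xr: "(x + of_rat r) ^ m = of_rat b"
  shows "x \<in> \<rat>"
proof -
  \<comment> \<open>The roots of \<open>p\<close> lie on the circle of radius \<open>x\<close> about
    0, those of \<open>q\<close> on the circle of radius \<open>x + r\<close> about
    \<open>-r\<close>.\<close>
  define p where "p = monom 1 n - [:d:]"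
  define q where "q = [:r, 1:] ^ m - [:b:]"
  have P: "map_poly of_rat p = monom 1 n - [:of_rat d :: complex:]"
    by (simp add: p_def map_poly_of_rat_diff map_poly_monom map_poly_pCons)
  have Q: "map_poly of_rat q = [:of_rat r, 1:] ^ m - [:of_rat b :: complex:]"
    by (simp add: q_def map_poly_of_rat_diff map_poly_of_rat_power map_poly_pCons)
  have of_real_rat: "complex_of_real (of_rat w) = of_rat w" for w
    by (cases w) (simp add: of_rat_rat)
  have xc: "complex_of_real x ^ n = of_rat d"
    by (metis x of_real_power of_real_rat)
  have xrc: "(complex_of_real x + of_rat r) ^ m = of_rat b"
    by (metis xr of_real_power of_real_rat of_real_add)
  have "complex_of_real x \<in> \<rat>"
  proof (rule unique_simple_common_root_in_Rats)
    show "poly (map_poly of_rat p) (complex_of_real x) = 0"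
      by (simp add: P poly_monom xc)
    show "poly (map_poly of_rat q) (complex_of_real x) = 0"
      using xrc by (simp add: Q poly_power add.commute)
    \<comment> \<open>The derivative at \<open>x\<close> is \<open>n * x ^ (n - 1)\<close>, nonzero
      since \<open>x\<close> and \<open>n\<close> are positive.\<close>
    show "poly (pderiv (map_poly of_rat p)) (complex_of_real x) \<noteq> 0"
      using assms by (simp add: P pderiv_diff pderiv_monom poly_monom pderiv_pCons)
  next
    fix z :: complex
    assume "poly (map_poly of_rat p) z = 0" "poly (map_poly of_rat q) z = 0"
    hence "z ^ n = complex_of_real x ^ n" "(z + of_rat r) ^ m = (complex_of_real x + of_rat r) ^ m"
      using xrc by (simp_all add: P Q poly_monom poly_power xc add.commute)
    \<comment> \<open>Equal powers determine the bases only up to roots of unity; taking norms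
      removes this ambiguity.\<close>
    hence "norm (z ^ n) = norm (complex_of_real x ^ n)"
      "norm ((z + of_rat r) ^ m) = norm (complex_of_real (x + of_rat r) ^ m)"
      by (simp_all add: of_real_rat)
    hence pow: "norm z ^ n = x ^ n" "norm (z + of_rat r) ^ m = (x + of_rat r) ^ m"
      using assms(1,2) by (simp_all only: norm_power norm_of_real) simp_all
    have "norm z = x"
      using pow(1) by (rule power_eq_imp_eq_base) (use assms in simp_all)
    moreover have "norm (z + of_rat r) = x + of_rat r"
      using pow(2) by (rule power_eq_imp_eq_base) (use assms in simp_all)
    ultimately show "z = of_real x"
      using complex_eq_of_norm_add_real[of z x "of_rat r"] \<open>r > 0\<close> by (simp add: of_real_rat)
  qed
  thus ?thesis by simp
qed

lemma root_add_neq_root: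
  fixes b d r :: rat
  assumes "b > 0" "d > 0" "r > 0" "m > 0" "n > 0" "root n (of_rat d) \<notin> \<rat>"
  shows "root n (of_rat d) + of_rat r \<noteq> root m (of_rat b)"
proof
  assume eq: "root n (of_rat d) + of_rat r = root m (of_rat b)"
  have "root n (of_rat d) \<in> \<rat>"
    by (rule Rats_of_power_and_shifted_power[of _ r m n d b]) (use assms in \<open>simp_all add: eq\<close>)
  with assms show False by simp
qed

theorem mainTheorem3:
  fixes a b c d :: rat and m n :: nat
  assumes "b > 0" and "d > 0"
    and "m > 1" and "n > 1"
    and "root m (of_rat b) \<notin> \<rat>" and "root n (of_rat d) \<notin> \<rat>"
    and "of_rat a + root m (of_rat b) = of_rat c + root n (of_rat d)"
  shows "a = c \<and> root m (of_rat b) = root n (of_rat d)"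
proof -
  have "c \<le> a"
  proof (rule leI, rule notI)
    \<comment> \<open>The equation now reads \<open>root n d + (c - a) = root m b\<close> with a
      positive rational shift; irrationality of \<open>root n d\<close> excludes it.\<close>
    assume "a < c"
    with root_add_neq_root[of b d "c - a" m n] assms show False
      by (simp add: of_rat_diff)
  qed
  moreover have "a \<le> c"
  proof (rule leI, rule notI)
    \<comment> \<open>The mirror case, with the two roots exchanged, rests on the irrationality of
      \<open>root m b\<close>.\<close>
    assume "c < a"
    with root_add_neq_root[of d b "a - c" n m] assms show False
      by (simp add: of_rat_diff)
  qed
  ultimately have "a = c" by simp
  with assms show ?thesis by simp
qed

end
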